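(* Let $n,k,c$ be positive integers with $n=kc$. Then $$SP(n,k)=\frac1k\binom{n}{c}.$$ Moreover, a Sperner partition system in $\mathcal{P}^n_k$ has cardinality $\frac1k\binom nc$ only if it is a $c$-uniform partition system.
   Context: $\mathcal{P}^n_k$ is the set of all $k$-partitions of $\{1,\dots,n\}$, i.e. partitions into exactly $k$ non-empty classes. Two partitions $P=\{P_1,\dots,P_k\}$ and $Q=\{Q_1,\dots,Q_k\}$ in $\mathcal{P}^n_k$ have the Sperner property if $P_i\not\subseteq Q_j$ and $Q_i\not\subseteq P_j$ for all $i,j\in\{1,\dots,k\}$. A set $\mathcal{P}\subseteq\mathcal{P}^n_k$ is a Sperner partition system if all distinct $P,Q\in\mathcal{P}$ have the Sperner property. $SP(n,k)$ is the maximum cardinality of a Sperner partition system in $\mathcal{P}^n_k$. A partition system is $c$-uniform if every class of every partition in it has cardinality $c$. *)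

theory Defs
  imports Complex_Main "HOL-Library.Disjoint_Sets"
begin

definition k_partitions :: "nat \<Rightarrow> nat \<Rightarrow> nat set set set" where
  "k_partitions n k = {P. partition_on {1..n} P \<and> card P = k}"

definition sperner_property :: "nat set set \<Rightarrow> nat set set \<Rightarrow> bool" where
  "sperner_property P Q \<longleftrightarrow> (\<forall>A\<in>P. \<forall>B\<in>Q. \<not> A \<subseteq> B \<and> \<not> B \<subseteq> A)"

definition sperner_partition_system :: "nat \<Rightarrow> nat \<Rightarrow> nat set set set \<Rightarrow> bool" where
  "sperner_partition_system n k \<P> \<longleftrightarrow>
     \<P> \<subseteq> k_partitions n k \<and> (\<forall>P\<in>\<P>. \<forall>Q\<in>\<P>. P \<noteq> Q \<longrightarrow> sperner_property P Q)"

definition SP :: "nat \<Rightarrow> nat \<Rightarrow> nat" where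
  "SP n k = Max {card \<P> | \<P>. sperner_partition_system n k \<P>}"

definition uniform_system :: "nat \<Rightarrow> nat set set set \<Rightarrow> bool" where
  "uniform_system c \<P> \<longleftrightarrow> (\<forall>P\<in>\<P>. \<forall>A\<in>P. card A = c)"

lemma finite_k_partitions: "finite (k_partitions n k)"
proof (rule finite_subset)
  show "k_partitions n k \<subseteq> Pow (Pow {1..n})"
    by (auto simp: k_partitions_def partition_on_def)
qed simp

(* The maximum in SP is taken over a finite nonempty set. *)
lemma SP_set_finite: "finite {card \<P> | \<P>. sperner_partition_system n k \<P>}"
proof (rule finite_subset)
  show "{card \<P> | \<P>. sperner_partition_system n k \<P>} \<subseteq> card ` Pow (k_partitions n k)"
    by (auto simp: sperner_partition_system_def)
qed (simp add: finite_k_partitions)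

lemma SP_set_nonempty: "{card \<P> | \<P>. sperner_partition_system n k \<P>} \<noteq> {}"
proof -
  have "sperner_partition_system n k {}"
    by (simp add: sperner_partition_system_def)
  then show ?thesis by blast
qed

end

theory Submission
  imports Defs
begin

text \<open>
  Upper bound. A block lies in only one partition of a Sperner partition system, and all the
  blocks together form an antichain of subsets of \<open>{1..n}\<close>. The LYM inequality bounds the sum of
  \<open>1 / (n choose |A|)\<close> over these blocks by \<open>1\<close>. As a function of \<open>a\<close>, the weight
  \<open>1 / (n choose a)\<close> is strictly convex, and the \<open>k\<close> blocks of a partition have mean size \<open>c\<close>, so
  every partition contributes at least \<open>k / (n choose c)\<close>, with equality only if all its blocks have
  size \<open>c\<close>. Hence there are at most \<open>(n choose c) / k\<close> partitions, and this many only in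
  a \<open>c\<close>-uniform system (lemma \<open>sperner_partition_bound\<close>).

  Sharpness is Baranyai's theorem: the \<open>c\<close>-subsets of a set of \<open>k * c\<close> points can be
  split into partitions of that set. The proof follows Brouwer and Schrijver. The points are added
  one at a time to all \<open>M\<close> partitions simultaneously. After \<open>l\<close> points there are \<open>M\<close>
  partitions of \<open>{1..l}\<close> into \<open>k\<close> possibly empty classes, and each \<open>S \<subseteq> {1..l}\<close> occurs among the
  classes as often as there are ways to complete it to a \<open>c\<close>-set by later points. This
  statement is the strengthening that carries the induction: for \<open>l = k * c\<close> it says that each
  \<open>c\<close>-set occurs once and no other set occurs. To add a point, each partition has to choose the class
  that receives it, and each \<open>S\<close> has to be chosen a prescribed number of times. Choosing the class
  \<open>S\<close> with probability \<open>(c - |S|) / (k * c - l)\<close> meets these requirements in expectation;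
  Hall's theorem turns such a fractional solution into an integral one
  (lemma \<open>integral_assignment\<close>).
\<close>

section \<open>Hall's theorem with capacities\<close>

text \<open>
  The induction of Halmos and Vaughan. If some proper nonempty \<open>J\<close> uses up all the capacity of its
  neighbourhood \<open>U\<close>, then \<open>J\<close> is served within \<open>U\<close>, and the other elements still satisfy
  Hall's condition outside \<open>U\<close>. Otherwise every such \<open>J\<close> has a spare unit, so one element can be
  assigned to any neighbour of positive capacity without violating the condition for the rest.
\<close>
lemma hall_with_capacities:
  fixes N :: "'i \<Rightarrow> 's set" and d :: "'s \<Rightarrow> nat"
  assumes "finite I" and "\<And>i. i \<in> I \<Longrightarrow> finite (N i)"
    and "\<And>J. J \<subseteq> I \<Longrightarrow> card J \<le> (\<Sum>S\<in>\<Union>(N ` J). d S)"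
  shows "\<exists>f. (\<forall>i\<in>I. f i \<in> N i) \<and> (\<forall>S. card {i\<in>I. f i = S} \<le> d S)"
  using assms
proof (induction "card I" arbitrary: I N d rule: less_induct)
  case less
  note fin = less.prems(1,2) and hall = less.prems(3)
  consider (empty) "I = {}"
    | (tight) J where "J \<subset> I" "J \<noteq> {}" "card J = (\<Sum>S\<in>\<Union>(N ` J). d S)"
    | (slack) "I \<noteq> {}" "\<And>J. J \<subset> I \<Longrightarrow> J \<noteq> {} \<Longrightarrow> card J < (\<Sum>S\<in>\<Union>(N ` J). d S)"
    by (metis hall order_le_less psubset_imp_subset)
  then show ?case
  proof cases
    case empty
    then show ?thesis by simp
  next
    case tight
    define U where "U = \<Union>(N ` J)"
    have finJ: "finite J" using tight fin finite_subset by blast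
    have finU: "finite U" unfolding U_def using finJ fin tight by blast
    have "\<exists>f. (\<forall>i\<in>J. f i \<in> N i) \<and> (\<forall>S. card {i\<in>J. f i = S} \<le> d S)"
    proof (rule less.hyps)
      show "card J < card I" using tight(1) fin(1) by (rule psubset_card_mono[rotated])
      show "\<And>L. L \<subseteq> J \<Longrightarrow> card L \<le> (\<Sum>S\<in>\<Union>(N ` L). d S)"
        using hall tight by blast
    qed (use finJ fin tight in auto)
    then obtain f where f: "\<And>i. i \<in> J \<Longrightarrow> f i \<in> N i" "\<And>S. card {i\<in>J. f i = S} \<le> d S"
      by blast
    have "\<exists>g. (\<forall>i\<in>I - J. g i \<in> N i - U) \<and> (\<forall>S. card {i\<in>I - J. g i = S} \<le> d S)"
    proof (rule less.hyps)
      show "card (I - J) < card I"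
        using tight(1,2) by (intro psubset_card_mono[OF fin(1)]) blast
      fix L assume L: "L \<subseteq> I - J"
      have finL: "finite L" using L fin finite_subset by blast
      have "card L + card J = card (L \<union> J)"
        using L finL finJ by (subst card_Un_disjoint) auto
      also have "\<dots> \<le> (\<Sum>S\<in>\<Union>(N ` (L \<union> J)). d S)"
        using hall L tight by blast
      also have "\<Union>(N ` (L \<union> J)) = \<Union>((\<lambda>i. N i - U) ` L) \<union> U"
        by (auto simp: U_def)
      also have "(\<Sum>S\<in>\<dots>. d S) = (\<Sum>S\<in>\<Union>((\<lambda>i. N i - U) ` L). d S) + (\<Sum>S\<in>U. d S)"
        using finL L fin finU by (intro sum.union_disjoint) auto
      finally show "card L \<le> (\<Sum>S\<in>\<Union>((\<lambda>i. N i - U) ` L). d S)"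
        using tight by (simp add: U_def)
    qed (use fin in auto)
    then obtain g where g: "\<And>i. i \<in> I - J \<Longrightarrow> g i \<in> N i - U"
        "\<And>S. card {i\<in>I - J. g i = S} \<le> d S"
      by blast
    define h where "h i = (if i \<in> J then f i else g i)" for i
    have "h i \<in> N i" if "i \<in> I" for i
      using that f(1) g(1) by (auto simp: h_def)
    moreover have "card {i\<in>I. h i = S} \<le> d S" for S
    proof (cases "S \<in> U")
      case True
      then have "i \<in> J" if "i \<in> I" "h i = S" for i
        using that g(1)[of i] by (auto simp: h_def split: if_splits)
      then have "{i\<in>I. h i = S} = {i\<in>J. f i = S}"
        using tight(1) by (intro Collect_cong) (metis h_def psubsetD)
      then show ?thesis using f(2) by simp
    next
      case False
      then have "{i\<in>I. h i = S} = {i\<in>I - J. g i = S}"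
        using f(1) by (auto simp: h_def U_def)
      then show ?thesis using g(2) by simp
    qed
    ultimately show ?thesis by blast
  next
    case slack
    then obtain i where i: "i \<in> I" by blast
    have "card {i} \<le> (\<Sum>S\<in>\<Union>(N ` {i}). d S)"
      using hall[of "{i}"] i by blast
    then have "(\<Sum>S\<in>N i. d S) \<noteq> 0" by simp
    then obtain T where T: "T \<in> N i" "d T > 0"
      by (metis bot_nat_0.not_eq_extremum sum.neutral)
    define e where "e = d(T := d T - 1)"
    have "\<exists>f. (\<forall>j\<in>I - {i}. f j \<in> N j) \<and> (\<forall>S. card {j\<in>I - {i}. f j = S} \<le> e S)"
    proof (rule less.hyps)
      show "card (I - {i}) < card I"
        using i fin(1) by (rule card_Diff1_less[rotated])
      fix J assume J: "J \<subseteq> I - {i}"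
      have finJ: "finite (\<Union>(N ` J))" using J fin finite_subset[of J I] by auto
      show "card J \<le> (\<Sum>S\<in>\<Union>(N ` J). e S)"
      proof (cases "J = {}")
        case False
        then have "card J < (\<Sum>S\<in>\<Union>(N ` J). d S)"
          using slack J i by blast
        also have "\<dots> \<le> (\<Sum>S\<in>\<Union>(N ` J). e S + (if S = T then 1 else 0))"
          by (rule sum_mono) (auto simp: e_def)
        also have "\<dots> \<le> (\<Sum>S\<in>\<Union>(N ` J). e S) + 1"
          using finJ by (simp add: sum.distrib)
        finally show ?thesis by simp
      qed simp
    qed (use fin in auto)
    then obtain f where f: "\<And>j. j \<in> I - {i} \<Longrightarrow> f j \<in> N j"
        "\<And>S. card {j\<in>I - {i}. f j = S} \<le> e S"
      by blast
    have "(f(i := T)) j \<in> N j" if "j \<in> I" for j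
      using that f(1) T by auto
    moreover have "card {j\<in>I. (f(i := T)) j = S} \<le> d S" for S
    proof (cases "S = T")
      case True
      then have "{j\<in>I. (f(i := T)) j = S} = insert i {j\<in>I - {i}. f j = T}"
        using i by auto
      then show ?thesis using f(2)[of T] T fin True by (simp add: e_def)
    next
      case False
      then have "{j\<in>I. (f(i := T)) j = S} = {j\<in>I - {i}. f j = S}" by auto
      then show ?thesis using f(2)[of S] False by (simp add: e_def)
    qed
    ultimately show ?thesis by blast
  qed
qed

text \<open>
  The ratios \<open>w (P i j) / q\<close> are a fractional choice of one entry in each row \<open>i\<close> of the array
  \<open>P\<close> in which the value \<open>S\<close> is chosen \<open>d S\<close> times in total. Summing the weights of the entries in
  a set of rows verifies Hall's condition, which gives an integral choice using each \<open>S\<close> at most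
  \<open>d S\<close> times. The total demand equals the number of rows, so all these bounds are attained.
\<close>
lemma integral_assignment:
  fixes P :: "'i \<Rightarrow> 'j \<Rightarrow> 's" and w d :: "'s \<Rightarrow> nat"
  assumes fin: "finite I" "finite K" and "q > 0"
    and row: "\<And>i. i \<in> I \<Longrightarrow> (\<Sum>j\<in>K. w (P i j)) = q"
    and col: "\<And>S. card {p\<in>I \<times> K. P (fst p) (snd p) = S} * w S = q * d S"
  shows "\<exists>f. (\<forall>i\<in>I. f i \<in> K) \<and> (\<forall>S. card {i\<in>I. P i (f i) = S} = d S)"
proof -
  define N where "N i = P i ` K" for i
  have finN: "finite (\<Union>(N ` J))" if "J \<subseteq> I" for J
    using that fin finite_subset[of J I] by (auto simp: N_def)
  have weight: "(\<Sum>p\<in>{p\<in>I \<times> K. P (fst p) (snd p) \<in> U}. w (P (fst p) (snd p))) = q * (\<Sum>S\<in>U. d S)"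
    if "finite U" for U
  proof -
    let ?X = "{p\<in>I \<times> K. P (fst p) (snd p) \<in> U}"
    have "(\<Sum>p\<in>?X. w (P (fst p) (snd p))) =
        (\<Sum>S\<in>U. \<Sum>p\<in>{p\<in>?X. P (fst p) (snd p) = S}. w (P (fst p) (snd p)))"
      using fin that by (intro sum.group[symmetric]) auto
    also have "\<dots> = (\<Sum>S\<in>U. card {p\<in>I \<times> K. P (fst p) (snd p) = S} * w S)"
    proof (rule sum.cong)
      fix S assume "S \<in> U"
      then have "{p\<in>?X. P (fst p) (snd p) = S} = {p\<in>I \<times> K. P (fst p) (snd p) = S}" by auto
      then show "(\<Sum>p\<in>{p\<in>?X. P (fst p) (snd p) = S}. w (P (fst p) (snd p))) =
          card {p\<in>I \<times> K. P (fst p) (snd p) = S} * w S" by simp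
    qed simp
    finally show ?thesis by (simp add: col sum_distrib_left)
  qed
  have rows: "(\<Sum>p\<in>J \<times> K. w (P (fst p) (snd p))) = q * card J" if "J \<subseteq> I" for J
  proof -
    have "(\<Sum>p\<in>J \<times> K. w (P (fst p) (snd p))) = (\<Sum>i\<in>J. \<Sum>j\<in>K. w (P i j))"
      by (simp add: sum.cartesian_product split_beta)
    also have "\<dots> = (\<Sum>i\<in>J. q)" using row that by (intro sum.cong) auto
    finally show ?thesis by simp
  qed
  have "\<exists>g. (\<forall>i\<in>I. g i \<in> N i) \<and> (\<forall>S. card {i\<in>I. g i = S} \<le> d S)"
  proof (rule hall_with_capacities)
    fix J assume J: "J \<subseteq> I"
    have "q * card J = (\<Sum>p\<in>J \<times> K. w (P (fst p) (snd p)))" using rows J by simp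
    also have "\<dots> \<le> (\<Sum>p\<in>{p\<in>I \<times> K. P (fst p) (snd p) \<in> \<Union>(N ` J)}. w (P (fst p) (snd p)))"
    proof (rule sum_mono2)
      show "J \<times> K \<subseteq> {p\<in>I \<times> K. P (fst p) (snd p) \<in> \<Union>(N ` J)}"
        using J by (force simp: N_def)
    qed (use fin in auto)
    also have "\<dots> = q * (\<Sum>S\<in>\<Union>(N ` J). d S)" by (rule weight[OF finN[OF J]])
    finally show "card J \<le> (\<Sum>S\<in>\<Union>(N ` J). d S)" using \<open>q > 0\<close> by simp
  qed (use fin in \<open>auto simp: N_def\<close>)
  then obtain g where g: "\<And>i. i \<in> I \<Longrightarrow> g i \<in> N i" "\<And>S. card {i\<in>I. g i = S} \<le> d S"
    by blast
  let ?U = "\<Union>(N ` I)"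
  have "{p\<in>I \<times> K. P (fst p) (snd p) \<in> ?U} = I \<times> K" by (force simp: N_def)
  then have "q * card I = q * (\<Sum>S\<in>?U. d S)"
    using weight[of ?U] rows[of I] finN by simp
  then have "(\<Sum>S\<in>?U. d S) = card I" using \<open>q > 0\<close> by simp
  also have "\<dots> = (\<Sum>i\<in>I. 1)" by simp
  also have "\<dots> = (\<Sum>S\<in>?U. \<Sum>i\<in>{i\<in>I. g i = S}. 1)"
    using fin(1) finN[OF subset_refl] g(1) by (intro sum.group[symmetric]) blast+
  finally have total: "(\<Sum>S\<in>?U. card {i\<in>I. g i = S}) = (\<Sum>S\<in>?U. d S)" by simp
  have eq: "card {i\<in>I. g i = S} = d S" for S
  proof (cases "S \<in> ?U")
    case True
    then show ?thesis
      using sum_mono_inv[OF total] g(2) finN by blast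
  next
    case False
    then have none: "{p\<in>I \<times> K. P (fst p) (snd p) = S} = {}" by (auto simp: N_def)
    have "d S = 0" using col[of S] \<open>q > 0\<close> unfolding none by simp
    then show ?thesis using g(2)[of S] by simp
  qed
  have "\<exists>j\<in>K. P i j = g i" if "i \<in> I" for i
    using g(1)[OF that] by (auto simp: N_def)
  then obtain f where f: "\<And>i. i \<in> I \<Longrightarrow> f i \<in> K \<and> P i (f i) = g i"
    by metis
  have "{i\<in>I. P i (f i) = S} = {i\<in>I. g i = S}" for S using f by auto
  then show ?thesis using f eq by metis
qed

section \<open>Baranyai's theorem\<close>

text \<open>
  The number of ways to complete an \<open>s\<close>-set to a \<open>c\<close>-set with elements of a disjoint \<open>m\<close>-set. The
  case distinction is needed because \<open>c - s = 0\<close> on the natural numbers for \<open>s > c\<close>.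
\<close>
definition completions :: "nat \<Rightarrow> nat \<Rightarrow> nat \<Rightarrow> nat" where
  "completions c m s = (if s \<le> c then m choose (c - s) else 0)"

text \<open>
  Pascal's rule: a completion either avoids or uses the next point. This is why the
  occurrences of \<open>S\<close> split correctly into those that receive this point and those that do not.
\<close>
lemma completions_Suc:
  "completions c (Suc m) s = completions c m s + completions c m (Suc s)"
proof (cases "s < c")
  case True
  then have "c - s = Suc (c - Suc s)" by simp
  with True show ?thesis by (simp add: completions_def)
qed (simp add: completions_def)

text \<open>
  Double counting of the completions with a marked new point. It says that the fractional choice
  with weights \<open>(c - s) / Suc m\<close> selects an \<open>s\<close>-set exactly as often as its enlargement by
  the next point has to occur.
\<close>
lemma completions_absorb:
  "completions c (Suc m) s * (c - s) = Suc m * completions c m (Suc s)"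
proof (cases "s < c")
  case True
  then have "c - s = Suc (c - Suc s)" by simp
  with True show ?thesis
    using Suc_times_binomial_eq[of m "c - Suc s"] by (simp add: completions_def mult.commute)
qed (simp add: completions_def)

lemma completions_0: "completions c 0 s = (if s = c then 1 else 0)"
  by (simp add: completions_def)

text \<open>
  The induction of Brouwer and Schrijver on the number \<open>l\<close> of points, with \<open>m\<close> points still to come.
  \<open>P i j\<close> is class \<open>j\<close> of partition \<open>i\<close>; indexing the classes lets the empty set occur
  several times within one partition, which is unavoidable in the first steps if \<open>k > 1\<close>.
\<close>
lemma baranyai_stage:
  fixes k c M :: nat
  assumes start: "k * M = (k * c) choose c" and "l + m = k * c"
  shows "\<exists>P :: nat \<Rightarrow> nat \<Rightarrow> nat set.
    (\<forall>i<M. disjoint_family_on (P i) {..<k} \<and> (\<Union>j<k. P i j) = {1..l}) \<and>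
    (\<forall>S\<subseteq>{1..l}. card {p\<in>{..<M} \<times> {..<k}. P (fst p) (snd p) = S} = completions c m (card S))"
  using assms(2)
proof (induction l arbitrary: m)
  case 0
  have "{p\<in>{..<M} \<times> {..<k}. True} = {..<M} \<times> {..<k}" by simp
  then show ?case
    using start 0
    by (intro exI[of _ "\<lambda>_ _. {}"])
      (auto simp: disjoint_family_on_def completions_def card_cartesian_product mult.commute simp del: mem_Sigma_iff)
next
  case (Suc l)
  obtain P :: "nat \<Rightarrow> nat \<Rightarrow> nat set"
    where dis: "\<And>i. i < M \<Longrightarrow> disjoint_family_on (P i) {..<k}"
      and un: "\<And>i. i < M \<Longrightarrow> (\<Union>j<k. P i j) = {1..l}"
      and cnt: "\<And>S. S \<subseteq> {1..l} \<Longrightarrow>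
        card {p\<in>{..<M} \<times> {..<k}. P (fst p) (snd p) = S} = completions c (Suc m) (card S)"
    using Suc.IH[of "Suc m"] Suc.prems by auto
  have sub: "P i j \<subseteq> {1..l}" if "i < M" "j < k" for i j
    using un that by blast
  have small: "card (P i j) \<le> c" if "i < M" "j < k" for i j
  proof (rule ccontr)
    assume "\<not> card (P i j) \<le> c"
    then have "card {p\<in>{..<M} \<times> {..<k}. P (fst p) (snd p) = P i j} = 0"
      using cnt[OF sub[OF that]] by (simp add: completions_def)
    then have "{p\<in>{..<M} \<times> {..<k}. P (fst p) (snd p) = P i j} = {}"
      by (subst (asm) card_0_eq) auto
    then show False using that by auto
  qed
  \<comment> \<open>\<open>S\<close> must receive the new point as often as \<open>insert (Suc l) S\<close> is to occur afterwards.\<close>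
  define d where "d S = (if S \<subseteq> {1..l} then completions c m (Suc (card S)) else 0)" for S :: "nat set"
  \<comment> \<open>A class weighs as much as it lacks elements; a partition of \<open>l\<close> points then weighs
    \<open>k * c - l = Suc m\<close>.\<close>
  have "\<exists>f. (\<forall>i\<in>{..<M}. f i \<in> {..<k}) \<and> (\<forall>S. card {i\<in>{..<M}. P i (f i) = S} = d S)"
  proof (rule integral_assignment[where q = "Suc m" and w = "\<lambda>S. c - card S"])
    fix i assume i: "i \<in> {..<M}"
    have "(\<Sum>j<k. c - card (P i j)) + (\<Sum>j<k. card (P i j)) = (\<Sum>j<k. c)"
      using small i by (simp flip: sum.distrib)
    moreover have "(\<Sum>j<k. card (P i j)) = card (\<Union>j<k. P i j)"
      using dis[of i] i finite_subset[OF sub]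
      by (intro card_UN_disjoint[symmetric]) (auto simp: disjoint_family_on_def)
    ultimately show "(\<Sum>j<k. c - card (P i j)) = Suc m"
      using un[of i] i Suc.prems by simp
  next
    fix S
    show "card {p\<in>{..<M} \<times> {..<k}. P (fst p) (snd p) = S} * (c - card S) = Suc m * d S"
    proof (cases "S \<subseteq> {1..l}")
      case True
      then show ?thesis by (simp only: cnt completions_absorb d_def if_True)
    next
      case False
      then have "{p\<in>{..<M} \<times> {..<k}. P (fst p) (snd p) = S} = {}" using sub by auto
      then show ?thesis using False by (simp only: d_def card.empty if_False mult_0 mult_0_right)
    qed
  qed auto
  then obtain f where fk: "\<And>i. i < M \<Longrightarrow> f i < k"
    and f: "\<And>S. card {i\<in>{..<M}. P i (f i) = S} = d S" by auto
  define Q where "Q i j = (if j = f i then insert (Suc l) (P i j) else P i j)" for i j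
  have new: "Suc l \<notin> P i j" if "i < M" "j < k" for i j
    using sub[OF that] by auto
  have "disjoint_family_on (Q i) {..<k}" if "i < M" for i
    using dis[OF that] new[OF that] by (auto simp: disjoint_family_on_def Q_def)
  moreover have "(\<Union>j<k. Q i j) = {1..Suc l}" if "i < M" for i
  proof -
    have "(\<Union>j<k. Q i j) = insert (Suc l) (\<Union>j<k. P i j)"
      using fk[OF that] by (auto simp: Q_def split: if_splits)
    then show ?thesis using un[OF that] by (simp add: atLeastAtMostSuc_conv)
  qed
  moreover have "card {p\<in>{..<M} \<times> {..<k}. Q (fst p) (snd p) = S} = completions c m (card S)"
    if S: "S \<subseteq> {1..Suc l}" for S
  proof -
    define chosen where "chosen T = (\<lambda>i. (i, f i)) ` {i\<in>{..<M}. P i (f i) = T}" for T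
    have cc: "card (chosen T) = d T" for T
      unfolding chosen_def using f by (subst card_image) (auto simp: inj_on_def)
    show ?thesis
    proof (cases "Suc l \<in> S")
      case True
      define T where "T = S - {Suc l}"
      have T: "S = insert (Suc l) T" "Suc l \<notin> T" "T \<subseteq> {1..l}"
        using True S by (auto simp: T_def atLeastAtMostSuc_conv)
      then have fT: "finite T" using finite_subset by blast
      have "Q i j = S \<longleftrightarrow> j = f i \<and> P i j = T" if "i < M" "j < k" for i j
        using new[OF that] T(1,2) by (auto simp: Q_def insert_ident)
      then have "p \<in> {p\<in>{..<M} \<times> {..<k}. Q (fst p) (snd p) = S} \<longleftrightarrow> p \<in> chosen T" for p
        using fk by (cases p) (fastforce simp: chosen_def)
      then have "{p\<in>{..<M} \<times> {..<k}. Q (fst p) (snd p) = S} = chosen T"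
        by blast
      then show ?thesis using cc[of T] T fT by (simp add: d_def)
    next
      case False
      then have S': "S \<subseteq> {1..l}" using S by (auto simp: atLeastAtMostSuc_conv)
      have "Q i j = S \<longleftrightarrow> P i j = S \<and> j \<noteq> f i" if "i < M" "j < k" for i j
        using False by (auto simp: Q_def)
      then have "p \<in> {p\<in>{..<M} \<times> {..<k}. Q (fst p) (snd p) = S} \<longleftrightarrow>
          p \<in> {p\<in>{..<M} \<times> {..<k}. P (fst p) (snd p) = S} - chosen S" for p
        by (cases p) (fastforce simp: chosen_def)
      then have "{p\<in>{..<M} \<times> {..<k}. Q (fst p) (snd p) = S} =
          {p\<in>{..<M} \<times> {..<k}. P (fst p) (snd p) = S} - chosen S"
        by blast
      moreover have "chosen S \<subseteq> {p\<in>{..<M} \<times> {..<k}. P (fst p) (snd p) = S}"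
        using fk by (auto simp: chosen_def)
      ultimately have "card {p\<in>{..<M} \<times> {..<k}. Q (fst p) (snd p) = S} =
          completions c (Suc m) (card S) - d S"
        using cc[of S] cnt[OF S'] by (simp add: card_Diff_subset finite_subset chosen_def)
      then show ?thesis using S' by (simp add: d_def completions_Suc)
    qed
  qed
  ultimately show ?case by blast
qed

lemma times_binomial_pred:
  fixes k c :: nat
  assumes "k > 0" "c > 0"
  shows "k * ((k * c - 1) choose (c - 1)) = (k * c) choose c"
proof -
  have "c * ((k * c) choose c) = c * (k * ((k * c - 1) choose (c - 1)))"
    using times_binomial_minus1_eq[of c "k * c"] assms by simp
  then show ?thesis using assms by simp
qed

text \<open>
  With no points left, each \<open>c\<close>-set occurs exactly once as a class. So the partitions are distinct,
  and two of their classes are comparable only if they are equal.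
\<close>
theorem baranyai:
  fixes k c :: nat
  assumes "k > 0" "c > 0"
  shows "\<exists>\<P>. sperner_partition_system (k * c) k \<P> \<and> k * card \<P> = (k * c) choose c"
proof -
  define M where "M = (k * c - 1) choose (c - 1)"
  have kM: "k * M = (k * c) choose c" unfolding M_def by (rule times_binomial_pred[OF assms])
  obtain P :: "nat \<Rightarrow> nat \<Rightarrow> nat set"
    where un: "\<And>i. i < M \<Longrightarrow> (\<Union>j<k. P i j) = {1..k * c}"
      and dis: "\<And>i. i < M \<Longrightarrow> disjoint_family_on (P i) {..<k}"
      and cnt: "\<And>S. S \<subseteq> {1..k * c} \<Longrightarrow>
        card {p\<in>{..<M} \<times> {..<k}. P (fst p) (snd p) = S} = (if card S = c then 1 else 0)"
    using baranyai_stage[OF kM, of "k * c" 0] by (auto simp: completions_0)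
  have sub: "P i j \<subseteq> {1..k * c}" if "i < M" "j < k" for i j
    using un that by blast
  have size: "card (P i j) = c" if "i < M" "j < k" for i j
  proof (rule ccontr)
    assume "card (P i j) \<noteq> c"
    then have "card {p\<in>{..<M} \<times> {..<k}. P (fst p) (snd p) = P i j} = 0"
      using cnt[OF sub[OF that]] by simp
    then have "{p\<in>{..<M} \<times> {..<k}. P (fst p) (snd p) = P i j} = {}"
      by (subst (asm) card_0_eq) auto
    then show False using that by auto
  qed
  have once: "i = i' \<and> j = j'"
    if "i < M" "j < k" "i' < M" "j' < k" "P i j = P i' j'" for i j i' j'
  proof -
    have "card {p\<in>{..<M} \<times> {..<k}. P (fst p) (snd p) = P i j} = 1"
      using cnt[OF sub] size that by simp
    then obtain x where "{p\<in>{..<M} \<times> {..<k}. P (fst p) (snd p) = P i j} = {x}"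
      by (auto simp: card_1_singleton_iff)
    moreover have "(i, j) \<in> {p\<in>{..<M} \<times> {..<k}. P (fst p) (snd p) = P i j}"
      "(i', j') \<in> {p\<in>{..<M} \<times> {..<k}. P (fst p) (snd p) = P i j}"
      using that by auto
    ultimately show ?thesis by (metis Pair_inject singletonD)
  qed
  define \<P> where "\<P> = (\<lambda>i. P i ` {..<k}) ` {..<M}"
  have "inj_on (\<lambda>i. P i ` {..<k}) {..<M}"
  proof (rule inj_onI)
    fix i i' assume i: "i \<in> {..<M}" "i' \<in> {..<M}" and eq: "P i ` {..<k} = P i' ` {..<k}"
    have "P i 0 \<in> P i' ` {..<k}" using eq assms by (metis imageI lessThan_iff)
    then show "i = i'" using once i assms by auto
  qed
  then have "card \<P> = M" by (simp add: \<P>_def card_image)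
  moreover have "sperner_partition_system (k * c) k \<P>"
    unfolding sperner_partition_system_def
  proof (intro conjI ballI impI subsetI)
    fix A assume "A \<in> \<P>"
    then obtain i where i: "i < M" "A = P i ` {..<k}" by (auto simp: \<P>_def)
    have "inj_on (P i) {..<k}" using once i by (auto simp: inj_on_def)
    then have "card A = k" using i by (simp add: card_image)
    moreover have "partition_on {1..k * c} A"
    proof (rule partition_onI)
      show "\<Union>A = {1..k * c}" using un i by simp
      show "{} \<notin> A" using size assms i by fastforce
      show "disjnt X Y" if XY: "X \<in> A" "Y \<in> A" "X \<noteq> Y" for X Y
      proof -
        obtain j j' where j: "j < k" "X = P i j" "j' < k" "Y = P i j'"
          using XY i by (auto simp: image_iff)
        then have "j \<noteq> j'" using XY by blast
        with j show ?thesis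
          using disjoint_family_onD[OF dis[OF i(1)], of j j'] by (simp add: disjnt_def)
      qed
    qed
    ultimately show "A \<in> k_partitions (k * c) k" by (simp add: k_partitions_def)
  next
    fix A B assume "A \<in> \<P>" "B \<in> \<P>" "A \<noteq> B"
    then obtain i i' where i: "i < M" "A = P i ` {..<k}" "i' < M" "B = P i' ` {..<k}" "i \<noteq> i'"
      by (auto simp: \<P>_def)
    have "P i j = P i' j'" if "P i j \<subseteq> P i' j' \<or> P i' j' \<subseteq> P i j" "j < k" "j' < k" for j j'
      using that sub size i by (metis card_subset_eq finite_atLeastAtMost finite_subset)
    then show "sperner_property A B" using once i unfolding sperner_property_def by blast
  qed
  ultimately show ?thesis using kM by blast
qed

section \<open>The LYM inequality\<close>

text \<open>
  Induction on the ground set. Unless \<open>\<F> = {X}\<close>, delete each point \<open>x\<close> in turn and apply the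
  inequality to the members that avoid \<open>x\<close>. A member \<open>A\<close> is counted \<open>|X| - |A|\<close> times, which is
  exactly the factor that relates its two weights:
  \<open>(|X| - |A|) / ((|X| - 1) choose |A|) = |X| / (|X| choose |A|)\<close>.
\<close>
lemma LYM_inequality:
  assumes "finite X" "\<F> \<subseteq> Pow X" and "\<And>A B. A \<in> \<F> \<Longrightarrow> B \<in> \<F> \<Longrightarrow> A \<subseteq> B \<Longrightarrow> A = B"
  shows "(\<Sum>A\<in>\<F>. 1 / real (card X choose card A)) \<le> 1"
  using assms
proof (induction "card X" arbitrary: X \<F>)
  case 0
  then have "\<F> \<subseteq> {{}}" by auto
  then have "\<F> = {} \<or> \<F> = {{}}" by blast
  then show ?case by auto
next
  case (Suc n)
  note fin = Suc.prems(1) and sub = Suc.prems(2) and anti = Suc.prems(3)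
  have finF: "finite \<F>" using fin sub by (simp add: finite_subset)
  show ?case
  proof (cases "X \<in> \<F>")
    case True
    then have "\<F> = {X}" using sub anti by blast
    then show ?thesis by simp
  next
    case False
    have weight: "real (card (X - A)) * (1 / real (n choose card A)) =
        real (Suc n) * (1 / real (card X choose card A))" if "A \<in> \<F>" for A
    proof -
      have A: "A \<subset> X" using that sub False by auto
      then have lt: "card A < Suc n" using fin Suc.hyps(2) by (metis psubset_card_mono)
      have "card (X - A) = Suc n - card A"
        using A fin Suc.hyps(2) by (metis card_Diff_subset finite_subset psubset_imp_subset)
      moreover have "(Suc n - card A) * (Suc n choose card A) = Suc n * (n choose card A)"
        using binomial_absorb_comp[of "Suc n" "card A"] by simp
      then have "real (Suc n - card A) * real (Suc n choose card A) = real (Suc n) * real (n choose card A)"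
        by (metis of_nat_mult)
      moreover have "real (Suc n choose card A) > 0" "real (n choose card A) > 0"
        using lt by (simp_all add: zero_less_binomial)
      ultimately show ?thesis
        unfolding Suc.hyps(2)[symmetric] by (simp add: field_simps del: of_nat_Suc)
    qed
    have "real (Suc n) * (\<Sum>A\<in>\<F>. 1 / real (card X choose card A)) =
        (\<Sum>A\<in>\<F>. real (card (X - A)) * (1 / real (n choose card A)))"
      by (simp only: sum_distrib_left weight cong: sum.cong)
    also have "\<dots> = (\<Sum>A\<in>\<F>. \<Sum>x\<in>{x\<in>X. x \<notin> A}. 1 / real (n choose card A))"
      by (simp add: set_diff_eq)
    also have "\<dots> = (\<Sum>x\<in>X. \<Sum>A\<in>{A\<in>\<F>. x \<notin> A}. 1 / real (n choose card A))"
      by (rule sum.swap_restrict[OF finF fin])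
    also have "\<dots> \<le> (\<Sum>x\<in>X. 1)"
    proof (rule sum_mono)
      fix x assume x: "x \<in> X"
      have n: "n = card (X - {x})" using x fin Suc.hyps(2) by simp
      have "(\<Sum>A\<in>{A\<in>\<F>. x \<notin> A}. 1 / real (card (X - {x}) choose card A)) \<le> 1"
        by (rule Suc.hyps(1)[OF n]) (use fin sub anti in auto)
      then show "(\<Sum>A\<in>{A\<in>\<F>. x \<notin> A}. 1 / real (n choose card A)) \<le> 1"
        using n by simp
    qed
    also have "\<dots> = real (Suc n)" using Suc.hyps(2) by simp
    finally show ?thesis by (simp only: mult_le_cancel_left1 mult_le_cancel_left2 of_nat_0_less_iff zero_less_Suc)
  qed
qed

section \<open>Convexity of reciprocal binomial coefficients\<close>

text \<open>
  With \<open>u = a + 1\<close> and \<open>v = n - a - 1\<close>, the two neighbours of \<open>h = 1 / (n choose (a + 1))\<close> are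
  \<open>h * (v + 1) / u\<close> and \<open>h * (u + 1) / v\<close>, and \<open>v / u + u / v \<ge> 2\<close>.
\<close>
lemma inverse_binomial_strictly_convex:
  fixes n a :: nat
  assumes "Suc a < n"
  shows "2 / real (n choose Suc a) < 1 / real (n choose a) + 1 / real (n choose Suc (Suc a))"
proof -
  define u v where "u = real (Suc a)" and "v = real (n - Suc a)"
  define h where "h = 1 / real (n choose Suc a)"
  have pos: "u > 0" "v > 0" "h > 0"
    using assms by (simp_all add: u_def v_def h_def zero_less_binomial)
  have "real (Suc a * (n choose Suc a)) = real ((n - a) * (n choose a))"
    by (metis binomial_absorb_comp binomial_absorption)
  moreover have v1: "real (n - a) = v + 1" using assms by (simp add: v_def)
  ultimately have absorb: "u * real (n choose Suc a) = (v + 1) * real (n choose a)"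
    unfolding u_def of_nat_mult by simp
  have "h * ((v + 1) / u) = (v + 1) / (u * real (n choose Suc a))"
    by (simp add: h_def mult.commute)
  also have "\<dots> = 1 / real (n choose a)"
    unfolding absorb using pos by simp
  finally have down: "1 / real (n choose a) = h * ((v + 1) / u)" ..
  have "real (Suc (Suc a) * (n choose Suc (Suc a))) = real ((n - Suc a) * (n choose Suc a))"
    by (metis binomial_absorb_comp binomial_absorption)
  moreover have "real (Suc (Suc a)) = u + 1" by (simp add: u_def)
  ultimately have absorb: "(u + 1) * real (n choose Suc (Suc a)) = v * real (n choose Suc a)"
    unfolding v_def by (metis of_nat_mult)
  have "h * ((u + 1) / v) = (u + 1) / (v * real (n choose Suc a))"
    by (simp add: h_def mult.commute)
  also have "\<dots> = 1 / real (n choose Suc (Suc a))"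
    unfolding absorb[symmetric] using pos by simp
  finally have up: "1 / real (n choose Suc (Suc a)) = h * ((u + 1) / v)" ..
  have "2 * (u * v) < (v + 1) * v + (u + 1) * u"
    using sum_squares_bound[of u v] pos by (simp add: power2_eq_square algebra_simps)
  then have "2 < (v + 1) / u + (u + 1) / v"
    using pos by (simp add: field_simps)
  then have "h * 2 < h * ((v + 1) / u + (u + 1) / v)"
    using pos by (simp only: mult_less_cancel_left_pos)
  then show ?thesis by (simp add: down up distrib_left) (simp add: h_def)
qed

text \<open>
  A convex sequence lies above the line through two consecutive points. The line through
  \<open>c - 1\<close> and \<open>c\<close> is available also for \<open>c = n\<close>. It may touch the sequence at \<open>c - 1\<close>,
  so strictness is claimed only above \<open>c\<close>; this is enough for sizes with mean \<open>c\<close>.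
\<close>
lemma inverse_binomial_above_chord:
  fixes n c a :: nat
  assumes "0 < c" "c \<le> n" "a \<le> n"
  defines "s \<equiv> 1 / real (n choose c) - 1 / real (n choose (c - 1))"
  shows "1 / real (n choose c) + s * (real a - real c) \<le> 1 / real (n choose a)" (is ?le)
    and "c < a \<Longrightarrow> 1 / real (n choose c) + s * (real a - real c) < 1 / real (n choose a)"
proof -
  define h where "h a = 1 / real (n choose a)" for a
  define D where "D a = h (Suc a) - h a" for a
  have step: "D i < D (Suc i)" if "Suc i < n" for i
    using inverse_binomial_strictly_convex[OF that] by (simp add: D_def h_def)
  have mono: "D i \<le> D j" if "i \<le> j" "j < n" for i j
    using that by (induction j rule: dec_induct) (use step in force)+
  have s: "s = D (c - 1)" using assms by (simp add: s_def D_def h_def)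
  have above: "h c + s * real (Suc d) < h (c + Suc d)" if "c + Suc d \<le> n" for d
    using that
  proof (induction d)
    case 0
    have "D (c - 1) < D c" using step[of "c - 1"] assms 0 by simp
    then show ?case by (simp add: s D_def)
  next
    case (Suc d)
    have "s \<le> D (c + Suc d)" using mono[of "c - 1" "c + Suc d"] Suc.prems s by simp
    then show ?case using Suc by (simp add: D_def algebra_simps)
  qed
  have below: "h c \<le> h a + s * real d" if "c = a + d" for a d
    using that
  proof (induction d arbitrary: a)
    case (Suc d)
    have "D a \<le> s" using mono[of a "c - 1"] Suc.prems s assms by simp
    then show ?case using Suc.IH[of "Suc a"] Suc.prems by (simp add: D_def algebra_simps)
  qed simp
  show gt: "1 / real (n choose c) + s * (real a - real c) < 1 / real (n choose a)" if ca: "c < a"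
  proof -
    obtain d where "a = c + Suc d" using ca less_imp_Suc_add[of c a] by auto
    then show ?thesis using above[of d] assms by (simp add: h_def)
  qed
  show ?le
  proof (cases "c < a")
    case False
    then have "c = a + (c - a)" by simp
    from below[OF this] show ?thesis using False by (simp add: h_def of_nat_diff algebra_simps)
  qed (use gt in simp)
qed

section \<open>The upper bound and its equality case\<close>

text \<open>
  Replace each weight by the value of the chord at \<open>c\<close>; these values are affine in the block
  sizes, whose sum is \<open>k * c\<close>. In case of equality no block is larger than \<open>c\<close>, and since \<open>c\<close> is
  the mean size, no block is smaller either.
\<close>
lemma partition_weight:
  fixes n k c :: nat
  assumes "P \<in> k_partitions n k" and n: "n = k * c" "n > 0"
  shows "real k / real (n choose c) \<le> (\<Sum>A\<in>P. 1 / real (n choose card A))"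
    and "real k / real (n choose c) = (\<Sum>A\<in>P. 1 / real (n choose card A)) \<Longrightarrow> \<forall>A\<in>P. card A = c"
proof -
  have part: "partition_on {1..n} P" and k: "card P = k"
    using assms by (auto simp: k_partitions_def)
  have finP: "finite P" using part finite_elements by blast
  have sub: "A \<subseteq> {1..n}" if "A \<in> P" for A using that part by (auto simp: partition_on_def)
  have le_n: "card A \<le> n" if "A \<in> P" for A
    using card_mono[OF _ sub[OF that]] by simp
  have c: "0 < c" "c \<le> n" using n by auto
  have "(\<Sum>A\<in>P. card A) = card (\<Union>P)"
    using part sub by (intro card_Union_disjoint[symmetric])
      (auto simp: partition_on_def disjoint_def pairwise_def disjnt_def intro: finite_subset)
  then have sizes: "(\<Sum>A\<in>P. card A) = (\<Sum>A\<in>P. c)"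
    using part k n by (simp add: partition_on_def)
  define s where "s = 1 / real (n choose c) - 1 / real (n choose (c - 1))"
  define t where "t A = 1 / real (n choose c) + s * (real (card A) - real c)" for A :: "nat set"
  have "(\<Sum>A\<in>P. t A) = real k / real (n choose c) + s * (real (\<Sum>A\<in>P. card A) - real (\<Sum>A\<in>P. c))"
    using k by (simp add: t_def sum.distrib sum_subtractf flip: sum_distrib_left)
  then have sum_t: "(\<Sum>A\<in>P. t A) = real k / real (n choose c)" using sizes by simp
  have ge: "t A \<le> 1 / real (n choose card A)" if "A \<in> P" for A
    using inverse_binomial_above_chord(1)[OF c le_n[OF that]] by (simp add: t_def s_def)
  show "real k / real (n choose c) \<le> (\<Sum>A\<in>P. 1 / real (n choose card A))"
    unfolding sum_t[symmetric] by (rule sum_mono[OF ge])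
  assume eq: "real k / real (n choose c) = (\<Sum>A\<in>P. 1 / real (n choose card A))"
  have le_c: "card A \<le> c" if A: "A \<in> P" for A
  proof (rule ccontr)
    assume "\<not> card A \<le> c"
    then have "t A < 1 / real (n choose card A)"
      using inverse_binomial_above_chord(2)[OF c le_n[OF A]] by (simp add: t_def s_def)
    moreover have "(\<Sum>A\<in>P. t A) = (\<Sum>A\<in>P. 1 / real (n choose card A))"
      using sum_t eq by simp
    then have "t A = 1 / real (n choose card A)"
      by (rule sum_mono_inv[OF _ ge A finP])
    ultimately show False by simp
  qed
  show "\<forall>A\<in>P. card A = c"
    using sum_mono_inv[OF sizes le_c _ finP] by blast
qed

text \<open>
  Comparable blocks of different partitions are excluded by the Sperner property, and
  different blocks of one partition are disjoint and nonempty. So the blocks form an antichain.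
\<close>
lemma LYM_partition_system:
  assumes "sperner_partition_system n k \<P>"
  shows "(\<Sum>P\<in>\<P>. \<Sum>A\<in>P. 1 / real (n choose card A)) \<le> 1"
proof -
  have part: "partition_on {1..n} P" if "P \<in> \<P>" for P
    using assms that by (auto simp: sperner_partition_system_def k_partitions_def)
  have sperner: "\<not> A \<subseteq> B" if "P \<in> \<P>" "Q \<in> \<P>" "A \<in> P" "B \<in> Q" "P \<noteq> Q" for P Q A B
    using assms that by (auto simp: sperner_partition_system_def sperner_property_def)
  have "(\<Sum>P\<in>\<P>. \<Sum>A\<in>P. 1 / real (n choose card A)) = (\<Sum>A\<in>\<Union>\<P>. 1 / real (n choose card A))"
  proof (subst sum.Union_disjoint)
    show "\<forall>P\<in>\<P>. finite P" using part finite_elements by blast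
    show "\<forall>P\<in>\<P>. \<forall>Q\<in>\<P>. P \<noteq> Q \<longrightarrow> P \<inter> Q = {}" using sperner by blast
  qed simp
  also have "\<dots> = (\<Sum>A\<in>\<Union>\<P>. 1 / real (card {1..n} choose card A))" by simp
  also have "\<dots> \<le> 1"
  proof (rule LYM_inequality)
    show "\<Union>\<P> \<subseteq> Pow {1..n}" using part by (auto simp: partition_on_def)
    fix A B assume "A \<in> \<Union>\<P>" "B \<in> \<Union>\<P>" and AB: "A \<subseteq> B"
    then obtain P Q where PQ: "P \<in> \<P>" "Q \<in> \<P>" "A \<in> P" "B \<in> Q" by blast
    then have "P = Q" using sperner AB by blast
    then show "A = B"
      using PQ AB part[of P] unfolding partition_on_def disjoint_def by (metis inf.absorb1)
  qed simp
  finally show ?thesis .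
qed

lemma sperner_partition_bound:
  fixes n k c :: nat
  assumes sys: "sperner_partition_system n k \<P>" and n: "n = k * c" "n > 0"
  shows "k * card \<P> \<le> n choose c"
    and "k * card \<P> = n choose c \<Longrightarrow> uniform_system c \<P>"
proof -
  let ?w = "\<lambda>P. \<Sum>A\<in>P. 1 / real (n choose card A)"
  have sub: "\<P> \<subseteq> k_partitions n k" using sys by (simp add: sperner_partition_system_def)
  then have fin: "finite \<P>" using finite_k_partitions finite_subset by blast
  have "c \<le> n" using n by simp
  then have pos: "real (n choose c) > 0" by (simp add: zero_less_binomial)
  have ge: "real k / real (n choose c) \<le> ?w P" if "P \<in> \<P>" for P
    using partition_weight(1) n sub that by blast
  have le: "(\<Sum>P\<in>\<P>. real k / real (n choose c)) \<le> (\<Sum>P\<in>\<P>. ?w P)" by (rule sum_mono[OF ge])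
  also have "\<dots> \<le> 1" by (rule LYM_partition_system[OF sys])
  finally have "real (k * card \<P>) \<le> real (n choose c)" using pos by (simp add: field_simps)
  then show "k * card \<P> \<le> n choose c" by (simp only: of_nat_le_iff)
  assume "k * card \<P> = n choose c"
  then have "real k * real (card \<P>) = real (n choose c)" by (metis of_nat_mult)
  then have "(\<Sum>P\<in>\<P>. real k / real (n choose c)) = 1" using pos by (simp add: field_simps)
  then have eq: "(\<Sum>P\<in>\<P>. real k / real (n choose c)) = (\<Sum>P\<in>\<P>. ?w P)"
    using le LYM_partition_system[OF sys] by linarith
  have "real k / real (n choose c) = ?w P" if "P \<in> \<P>" for P
    using sum_mono_inv[OF eq ge that fin] by simp
  then show "uniform_system c \<P>"
    using partition_weight(2) n sub unfolding uniform_system_def by blast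
qed

theorem theorem7p1p5:
  fixes n k c :: nat
  assumes "n > 0" and "k > 0" and "c > 0" and "n = k * c"
  shows "real (SP n k) = 1 / real k * real (n choose c)
    \<and> (\<forall>\<P>. sperner_partition_system n k \<P> \<longrightarrow>
          real (card \<P>) = 1 / real k * real (n choose c) \<longrightarrow> uniform_system c \<P>)"
proof -
  have scale: "real a = 1 / real k * real (n choose c) \<longleftrightarrow> k * a = n choose c" for a
  proof -
    have "real a = 1 / real k * real (n choose c) \<longleftrightarrow> real (k * a) = real (n choose c)"
      using assms(2) by (simp add: eq_divide_eq mult.commute)
    then show ?thesis by (simp only: of_nat_eq_iff)
  qed
  obtain \<B> where \<B>: "sperner_partition_system n k \<B>" "k * card \<B> = n choose c"
    using baranyai assms by blast
  have "SP n k = card \<B>"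
    unfolding SP_def
  proof (rule Max_eqI[OF SP_set_finite])
    fix y assume "y \<in> {card \<P> |\<P>. sperner_partition_system n k \<P>}"
    then have "k * y \<le> k * card \<B>" using sperner_partition_bound(1) assms \<B> by auto
    then show "y \<le> card \<B>" using assms by simp
  qed (use \<B> in blast)
  then show ?thesis
    unfolding scale using \<B>(2) sperner_partition_bound(2)[OF _ assms(4,1)] by simp
qed

end
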